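(* Suppose $\alpha>0$. Let $\mathcal W_n=\max\{W[n,j]:-2\le j\le n\}$ be the maximal vertex weight after $n$ steps, and let $\mu=\sup\{\zeta_j: j\ge -2\}$. Then $\mu$ is a (almost surely) finite and positive random variable, and \[ \mathcal W_n\sim\mu\,n^{\alpha}\quad\text{almost surely as } n\to\infty, \] i.e. $\mathcal W_n/(\mu n^\alpha)\to1$ almost surely.
   Context: Random graph model with parameters $0<p\le 1$, $q,r\in[0,1]$. Vertices, edges and triangles carry nonnegative integer weights. At time $0$ there is a single triangle on three vertices; the triangle has weight $1$ and each of its three edges has weight $1$ (all other pairs/triplets have weight $0$). At each step $n=1,2,\dots$ three vertices interact, chosen as follows, all the choices of rule being independent of the past. With probability $p$ a new vertex is added and it interacts with two distinct old vertices: with (conditional) probability $r$ these are the endpoints of an edge chosen with probability proportional to its weight, and with probability $1-r$ they are two distinct old vertices chosen uniformly at random. With probability $1-p$ three old vertices interact: with (conditional) probability $q$ a triangle is chosen with probability proportional to its weight, and with probability $1-q$ three distinct old vertices are chosen uniformly at random. After the three interacting vertices are selected, any missing edges among them are drawn, and the weight of the triangle they form and of each of its three edges is increased by $1$. The weight of a vertex is the sum of the weights of the triangles containing it. The three initial vertices are labelled $-2,-1,0$; later vertices are labelled $1,2,\dots$ in the order they are added. $W[n,j]$ is the weight of vertex $j$ after step $n$ if it exists by then, and $0$ otherwise. Constant: $\alpha=(1-p)q+\frac{2pr}{3}$. Known fact (from earlier work) defining $\zeta_j$: for each fixed $j\ge-2$, $n^{-\alpha}W[n,j]$ converges almost surely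 as $n\to\infty$ to a positive random variable $\zeta_j$. *)

theory Defs
  imports "HOL-Probability.Probability"
begin

text \<open>
  The weight of a pair or triplet of vertices is its multiplicity in the multiset \<open>edges\<close>,
  respectively \<open>triangles\<close>; an edge or triangle is drawn iff its weight is positive.
  The three initial vertices are \<open>-2, -1, 0\<close> and the vertices added later are \<open>1, 2, \<dots>\<close>, so
  the vertex set is determined by the number \<open>added\<close> of vertices added so far.
\<close>

record wgraph =
  added :: nat
  edges :: "int set multiset"
  triangles :: "int set multiset"

definition vertices :: "wgraph \<Rightarrow> int set" where
  "vertices G = {-2..int (added G)}"

definition pairs :: "int set \<Rightarrow> int set set" where
  "pairs A = {e. e \<subseteq> A \<and> card e = 2}"

definition triplets :: "int set \<Rightarrow> int set set" where
  "triplets A = {T. T \<subseteq> A \<and> card T = 3}"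

definition vertex_weight :: "wgraph \<Rightarrow> int \<Rightarrow> nat" where
  "vertex_weight G j = (\<Sum>T | T \<in># triangles G \<and> j \<in> T. count (triangles G) T)"

definition initial_graph :: wgraph where
  "initial_graph =
     \<lparr>added = 0, edges = mset_set (pairs {-2, -1, 0}), triangles = {#{-2, -1, 0}#}\<rparr>"

definition interact :: "int set \<Rightarrow> wgraph \<Rightarrow> wgraph" where
  "interact T G =
     G\<lparr>edges := edges G + mset_set (pairs T), triangles := add_mset T (triangles G)\<rparr>"

definition add_vertex :: "wgraph \<Rightarrow> wgraph" where
  "add_vertex G = G\<lparr>added := Suc (added G)\<rparr>"

text \<open>
  Since weights are multiplicities, \<open>pmf_of_multiset\<close> is the choice with probability
  proportional to the weight.
\<close>

definition step :: "real \<Rightarrow> real \<Rightarrow> real \<Rightarrow> wgraph \<Rightarrow> wgraph pmf" where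
  "step p q r G =
     bind_pmf (bernoulli_pmf p) (\<lambda>new.
       if new then
         bind_pmf (bernoulli_pmf r) (\<lambda>preferential.
         bind_pmf (if preferential then pmf_of_multiset (edges G)
                   else pmf_of_set (pairs (vertices G))) (\<lambda>e.
         return_pmf (interact (insert (int (added G) + 1) e) (add_vertex G))))
       else
         bind_pmf (bernoulli_pmf q) (\<lambda>preferential.
         bind_pmf (if preferential then pmf_of_multiset (triangles G)
                   else pmf_of_set (triplets (vertices G))) (\<lambda>T.
         return_pmf (interact T G))))"

text \<open>
  The process \<open>X\<close> starts from the initial triangle, and given the whole past
  \<open>X 0, \<dots>, X n\<close> the graph \<open>X (n + 1)\<close> has distribution \<open>step p q r (X n)\<close>. Almost surely
  \<open>X\<close> only visits countably many states, so that prescribing the probability of every finite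
  history \<open>h\<close> fixes the law of \<open>X\<close>.
\<close>

definition graph_process ::
    "real \<Rightarrow> real \<Rightarrow> real \<Rightarrow> 'w measure \<Rightarrow> (nat \<Rightarrow> 'w \<Rightarrow> wgraph) \<Rightarrow> bool" where
  "graph_process p q r M X \<longleftrightarrow>
     prob_space M \<and>
     (\<forall>n. X n \<in> measurable M (count_space UNIV)) \<and>
     (AE \<omega> in M. X 0 \<omega> = initial_graph) \<and>
     (\<forall>n h. measure M {\<omega> \<in> space M. \<forall>i\<le>Suc n. X i \<omega> = h i} =
            measure M {\<omega> \<in> space M. \<forall>i\<le>n. X i \<omega> = h i} * pmf (step p q r (h n)) (h (Suc n)))"

definition max_weight :: "nat \<Rightarrow> wgraph \<Rightarrow> nat" where
  "max_weight n G = Max (vertex_weight G ` {-2..int n})"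

definition \<alpha> :: "real \<Rightarrow> real \<Rightarrow> real \<Rightarrow> real" where
  "\<alpha> p q r = (1 - p) * q + 2 * p * r / 3"

text \<open>The supremum is taken in the extended reals, so that its finiteness is a genuine claim.\<close>

definition \<mu> :: "(int \<Rightarrow> 'w \<Rightarrow> real) \<Rightarrow> 'w \<Rightarrow> ereal" where
  "\<mu> \<zeta> \<omega> = (SUP j\<in>{-2..}. ereal (\<zeta> j \<omega>))"

end

theory Submission
  imports Defs
begin

text \<open>
  Since every single column \<open>W[n, j]\<close> grows like \<open>\<zeta> j * n powr \<alpha>\<close>, the maximum over finitely many
  vertices is harmless, and the theorem amounts to the claim that late vertices cannot compete: for
  every \<open>e > 0\<close>, almost surely only finitely many \<open>j\<close> satisfy \<open>W[n, j] \<ge> e * n powr \<alpha>\<close> for some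
  \<open>n \<ge> 1\<close> (\<open>AE_young_vertices_small\<close>). Given this, both the supremum of the limits and, for large \<open>n\<close>,
  the maximal weight come from a fixed finite set of vertices, and the
  convergence of the maximum is elementary (\<open>max_asymptotics_of_columns\<close>).

  The claim about late vertices comes from a high-moment estimate. A vertex of weight \<open>w\<close> takes part in
  the interaction that leads from \<open>X n\<close> to \<open>X (n + 1)\<close> with probability at most
  \<open>\<alpha> * w / (n + 1) + 3 / V\<close>, where \<open>V\<close> is the
  number of vertices: a chosen triangle contains it with probability \<open>w / (n + 1)\<close>, a chosen edge with
  probability \<open>2/3\<close> of that, and a uniform choice of two or three vertices hits it with probability at
  most \<open>3 / V\<close> (\<open>prob_interaction_le\<close>). As long as \<open>V \<ge> c * n\<close>, this is at most
  \<open>\<alpha> * (w + a) / n\<close> with \<open>a = 3 / (c * \<alpha>)\<close>. Rising factorials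
  \<open>y * (y + 1) * \<dots> * (y + k - 1)\<close> are multiplied by
  \<open>1 + k / y\<close> when \<open>y\<close> increases by one, so for \<open>y = w + a\<close> the conditional mean of the rising factorial
  grows at most by the factor \<open>1 + \<alpha> * k / n \<le> ((n + 1) / n) powr (\<alpha> * k)\<close>. Hence its quotient by
  \<open>n powr (\<alpha> * k)\<close> is a nonnegative supermartingale up to the first time that \<open>V \<ge> c * n\<close> fails
  (\<open>potential_supermartingale\<close>). A vertex \<open>j\<close> is born with weight one at a time that is at least \<open>j\<close>, so this supermartingale starts at most at
  a constant times \<open>j powr (- \<alpha> * k)\<close>. The maximal inequality (\<open>maximal_inequality\<close>)
  bounds by a multiple of this the probability that \<open>j\<close> ever becomes heavy. For \<open>\<alpha> * k > 1\<close> these bounds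
  are summable in \<open>j\<close>, and the Borel-Cantelli lemma applies.

  That \<open>V\<close> eventually exceeds some \<open>c * n\<close> is a Chernoff bound for the number of added vertices
  (\<open>AE_linearly_many_vertices\<close>). All these computations take place in the discrete law of finite
  histories, which agrees with that of the process on events that depend on finitely many steps
  (\<open>prob_eq_history\<close>).
\<close>

section \<open>Choosing pairs and triplets\<close>

lemma card_subsets_containing:
  assumes "finite A" "j \<in> A"
  shows "card {e. e \<subseteq> A \<and> card e = Suc k \<and> j \<in> e} = (card A - 1) choose k"
proof -
  have "{e. e \<subseteq> A \<and> card e = Suc k \<and> j \<in> e} = insert j ` {e. e \<subseteq> A - {j} \<and> card e = k}" (is "?L = ?R")
  proof (intro equalityI subsetI)
    fix e assume e: "e \<in> ?L"
    then have "finite e" using assms finite_subset by auto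
    with e have "e = insert j (e - {j})" "e - {j} \<subseteq> A - {j}" "card (e - {j}) = k"
      by (auto simp: insert_absorb)
    then show "e \<in> ?R" by blast
  next
    fix e assume "e \<in> ?R"
    then obtain e' where e': "e = insert j e'" "e' \<subseteq> A - {j}" "card e' = k" by auto
    then have "finite e'" using assms finite_subset by blast
    with e' show "e \<in> ?L" using assms by (subst mem_Collect_eq) (auto simp: card_insert_if)
  qed
  moreover have "inj_on (insert j) {e. e \<subseteq> A - {j} \<and> card e = k}"
    by (rule inj_onI) (auto simp: insert_ident)
  ultimately show ?thesis
    using assms n_subsets[of "A - {j}" k] by (simp add: card_image)
qed

text \<open>
  For two or three vertices out of \<open>V\<close> this is the probability \<open>2 / V\<close> or \<open>3 / V\<close> that a given
  vertex takes part in a uniform interaction.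
\<close>

lemma prob_uniform_subset_contains:
  assumes A: "finite A" "j \<in> A" and k: "Suc k \<le> card A"
  shows "measure_pmf.prob (pmf_of_set {e. e \<subseteq> A \<and> card e = Suc k}) {e. j \<in> e}
       = real (Suc k) / real (card A)"
proof -
  let ?S = "{e. e \<subseteq> A \<and> card e = Suc k}"
  have card_S: "card ?S = card A choose Suc k"
    using A by (intro n_subsets)
  have pos: "card A choose Suc k > 0" using k by simp
  then have ne: "?S \<noteq> {}" using card_S by fastforce
  have fin: "finite ?S" using A by simp
  have "?S \<inter> {e. j \<in> e} = {e. e \<subseteq> A \<and> card e = Suc k \<and> j \<in> e}" by auto
  then have "measure_pmf.prob (pmf_of_set ?S) {e. j \<in> e}
      = real ((card A - 1) choose k) / real (card A choose Suc k)"
    using measure_pmf_of_set[OF ne fin] card_S card_subsets_containing[OF A] by simp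
  moreover have "real (Suc k) * real (card A choose Suc k) = real (card A) * real ((card A - 1) choose k)"
    using binomial_absorption[of k "card A"] by (metis of_nat_mult)
  moreover have "card A > 0" using k by simp
  ultimately show ?thesis using pos by (simp add: frac_eq_eq mult.commute)
qed

lemma prob_pmf_of_multiset:
  assumes "M \<noteq> {#}"
  shows "measure_pmf.prob (pmf_of_multiset M) {x. P x} = size {#x \<in># M. P x#} / size M"
proof -
  have "measure_pmf.prob (pmf_of_multiset M) {x. P x}
      = measure_pmf.prob (pmf_of_multiset M) (set_mset M \<inter> {x. P x})"
    using assms by (metis measure_Int_set_pmf set_pmf_of_multiset inf_commute)
  also have "\<dots> = (\<Sum>x\<in>set_mset M \<inter> {x. P x}. count M x / size M)"
    using assms by (subst measure_measure_pmf_finite) auto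
  also have "\<dots> = (\<Sum>x\<in>set_mset M \<inter> {x. P x}. real (count M x)) / size M"
    by (simp add: sum_divide_distrib)
  also have "(\<Sum>x\<in>set_mset M \<inter> {x. P x}. real (count M x)) = size {#x \<in># M. P x#}"
    by (auto simp: size_multiset_overloaded_eq intro!: sum.cong)
  finally show ?thesis .
qed

text \<open>
  Each interaction contributes three units of edge weight, two of them at every vertex of the triangle.
  Thus an edge chosen by weight contains a given vertex with two thirds of the probability with which
  a triangle chosen by weight contains it.
\<close>

lemma size_edges_of_triangles:
  assumes "\<forall>T\<in>#N. card T = 3"
  shows "size (\<Sum>T\<in>#N. mset_set (pairs T)) = 3 * size N"
    and "size {#e \<in># (\<Sum>T\<in>#N. mset_set (pairs T)). j \<in> e#} = 2 * size {#T \<in># N. j \<in> T#}"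
proof -
  have fin: "finite T" if "card T = 3" for T :: "int set" by (rule card_ge_0_finite) (simp add: that)
  have card3: "card (pairs T) = 3" "finite (pairs T)" if "card T = 3" for T
    using n_subsets[of T 2] fin[OF that] that by (simp_all add: pairs_def eval_nat_numeral)
  have card_j: "card {e \<in> pairs T. j \<in> e} = (if j \<in> T then 2 else 0)" if "card T = 3" for T
  proof (cases "j \<in> T")
    case True
    have "{e \<in> pairs T. j \<in> e} = {e. e \<subseteq> T \<and> card e = Suc 1 \<and> j \<in> e}"
      by (auto simp: pairs_def)
    then show ?thesis using card_subsets_containing[OF fin[OF that] True, of 1] that True by simp
  next
    case False
    then have none: "{e \<in> pairs T. j \<in> e} = {}" by (auto simp: pairs_def)
    show ?thesis unfolding none using False by simp
  qed
  show "size (\<Sum>T\<in>#N. mset_set (pairs T)) = 3 * size N"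
    using assms by (induction N) (auto simp: card3)
  show "size {#e \<in># (\<Sum>T\<in>#N. mset_set (pairs T)). j \<in> e#} = 2 * size {#T \<in># N. j \<in> T#}"
    using assms by (induction N) (auto simp: card3 card_j)
qed

section \<open>The probability of an interaction\<close>

text \<open>
  The invariant of the graph after \<open>n\<close> steps. The equation for the edges records that their weights are
  determined by those of the triangles; the bound on \<open>added\<close> says that vertex \<open>j\<close> is not born before
  time \<open>j\<close>.
\<close>

definition valid :: "nat \<Rightarrow> wgraph \<Rightarrow> bool" where
  "valid n G \<longleftrightarrow> size (triangles G) = Suc n \<and> added G \<le> n \<and>
     (\<forall>T\<in>#triangles G. T \<in> triplets (vertices G)) \<and>
     edges G = (\<Sum>T\<in>#triangles G. mset_set (pairs T))"

lemma vertex_weight_eq_size: "vertex_weight G j = size {#T \<in># triangles G. j \<in> T#}"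
proof -
  have "{T. T \<in># triangles G \<and> j \<in> T} = set_mset {#T \<in># triangles G. j \<in> T#}" by auto
  then show ?thesis
    unfolding vertex_weight_def size_multiset_overloaded_eq by (auto intro!: sum.cong)
qed

lemma vertex_weight_interact:
  "vertex_weight (interact T G) j = vertex_weight G j + (if j \<in> T then 1 else 0)"
  by (simp add: vertex_weight_eq_size interact_def)

lemma vertex_weight_add_vertex [simp]: "vertex_weight (add_vertex G) j = vertex_weight G j"
  by (simp add: vertex_weight_eq_size add_vertex_def)

lemma added_interact [simp]: "added (interact T G) = added G"
  by (simp add: interact_def)

lemma added_add_vertex [simp]: "added (add_vertex G) = Suc (added G)"
  by (simp add: add_vertex_def)

lemma vertices_finite [simp]: "finite (vertices G)"
  by (simp add: vertices_def)

lemma card_vertices [simp]: "card (vertices G) = added G + 3"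
  by (simp add: vertices_def)

lemma valid_initial: "valid 0 initial_graph"
proof -
  have "card {-2, -1, 0 :: int} = 3" by simp
  then show ?thesis
    by (auto simp: valid_def initial_graph_def triplets_def vertices_def)
qed

lemma valid_edges_mem:
  assumes "valid n G" "e \<in># edges G"
  shows "e \<in> pairs (vertices G)"
proof -
  obtain T where T: "T \<in># triangles G" "e \<in># mset_set (pairs T)"
    using assms by (auto simp: valid_def)
  then have "e \<in> pairs T" by (metis elem_mset_set empty_iff mset_set.infinite set_mset_empty)
  with T assms show ?thesis by (auto simp: valid_def pairs_def triplets_def)
qed

lemma vertex_weight_unborn:
  assumes "valid n G" "int (added G) < j"
  shows "vertex_weight G j = 0"
proof -
  have "j \<notin> T" if "T \<in># triangles G" for T
  proof
    assume "j \<in> T"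
    moreover have "T \<subseteq> {-2..int (added G)}"
      using that assms(1) by (auto simp: valid_def triplets_def vertices_def)
    ultimately show False using assms(2) by auto
  qed
  then show ?thesis by (simp add: vertex_weight_eq_size filter_mset_eq_conv)
qed

lemma valid_sizes:
  assumes "valid n G"
  shows "edges G \<noteq> {#}" "triangles G \<noteq> {#}"
    "size (edges G) = 3 * Suc n"
    "size {#e \<in># edges G. j \<in> e#} = 2 * vertex_weight G j"
proof -
  have c: "\<forall>T\<in>#triangles G. card T = 3" using assms by (auto simp: valid_def triplets_def)
  show s: "size (edges G) = 3 * Suc n"
    using assms size_edges_of_triangles(1)[OF c] by (simp add: valid_def)
  then show "edges G \<noteq> {#}" by auto
  show "triangles G \<noteq> {#}" using assms by (auto simp: valid_def)
  show "size {#e \<in># edges G. j \<in> e#} = 2 * vertex_weight G j"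
    using assms size_edges_of_triangles(2)[OF c] by (simp add: valid_def vertex_weight_eq_size)
qed

lemma pairs_triplets_vertices:
  "finite (pairs (vertices G))" "pairs (vertices G) \<noteq> {}"
  "finite (triplets (vertices G))" "triplets (vertices G) \<noteq> {}"
proof -
  show "finite (pairs (vertices G))" "finite (triplets (vertices G))"
    by (simp_all add: pairs_def triplets_def)
  have "{-2,-1} \<in> pairs (vertices G)" "{-2,-1,0} \<in> triplets (vertices G)"
    by (auto simp: pairs_def triplets_def vertices_def)
  then show "pairs (vertices G) \<noteq> {}" "triplets (vertices G) \<noteq> {}" by auto
qed

text \<open>
  An edge or triangle chosen by weight consists of existing vertices, so the preferential and
  the uniform rules need no separate treatment when only possible transitions matter.
\<close>

lemma set_pmf_step:
  assumes "valid n G" "G' \<in> set_pmf (step p q r G)"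
  obtains e where "e \<in> pairs (vertices G)" "G' = interact (insert (int (added G) + 1) e) (add_vertex G)"
  | T where "T \<in> triplets (vertices G)" "G' = interact T G"
proof -
  have tri: "T \<in> triplets (vertices G)" if "T \<in># triangles G" for T
    using that assms(1) by (simp add: valid_def)
  show thesis
    using assms(2) tri valid_edges_mem[OF assms(1)] that
    unfolding step_def
    by (auto simp: valid_sizes(1,2)[OF assms(1)] pairs_triplets_vertices split: if_splits)
qed

lemma valid_step:
  assumes "valid n G" "G' \<in> set_pmf (step p q r G)"
  shows "valid (Suc n) G'"
  using assms
proof (cases rule: set_pmf_step)
  case (1 e)
  have "finite e" using 1 finite_subset[of e "vertices G"] by (auto simp: pairs_def)
  moreover have "int (added G) + 1 \<notin> e" using 1 by (auto simp: pairs_def vertices_def)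
  ultimately have "card (insert (int (added G) + 1) e) = 3" using 1 by (simp add: pairs_def)
  moreover have "insert (int (added G) + 1) e \<subseteq> {-2..int (Suc (added G))}"
    using 1 by (auto simp: pairs_def vertices_def)
  moreover have "triplets (vertices G) \<subseteq> triplets {-2..int (Suc (added G))}"
    by (auto simp: triplets_def vertices_def)
  ultimately show ?thesis using assms(1) 1
    by (auto simp: valid_def interact_def add_vertex_def vertices_def triplets_def)
next
  case (2 T)
  then show ?thesis using assms(1)
    by (auto simp: valid_def interact_def vertices_def triplets_def)
qed

lemma prob_bernoulli_bind:
  assumes "x \<in> {0..1}"
  shows "measure_pmf.prob (bind_pmf (bernoulli_pmf x) f) A
       = x * measure_pmf.prob (f True) A + (1 - x) * measure_pmf.prob (f False) A"
proof -
  have "ennreal (measure_pmf.prob (bind_pmf (bernoulli_pmf x) f) A)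
      = emeasure (f True) A * x + emeasure (f False) A * (1 - x)"
    using assms by (simp flip: measure_pmf.emeasure_eq_measure)
  also have "\<dots> = ennreal (x * measure_pmf.prob (f True) A + (1 - x) * measure_pmf.prob (f False) A)"
    using assms by (simp add: measure_pmf.emeasure_eq_measure ennreal_mult ennreal_plus mult.commute)
  finally show ?thesis using assms by (subst (asm) ennreal_inj) auto
qed

text \<open>
  The preferential rules contribute exactly \<open>\<alpha> * w / (n + 1)\<close>, by the definition of \<open>\<alpha>\<close>. For the
  uniform rules a crude constant suffices, since it only enters through the shift of the weight in the
  supermartingale.
\<close>

lemma prob_interaction_le:
  assumes p: "p \<in> {0..1}" and q: "q \<in> {0..1}" and r: "r \<in> {0..1}"
    and G: "valid n G" and j: "j \<in> vertices G"
  shows "measure_pmf.prob (step p q r G) {G'. vertex_weight G' j = Suc (vertex_weight G j)}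
       \<le> \<alpha> p q r * vertex_weight G j / Suc n + 3 / (added G + 3)"
proof -
  let ?w = "vertex_weight G j" and ?v = "real (added G + 3)"
  let ?E = "{G'. vertex_weight G' j = Suc ?w}"
  have j_old: "j \<noteq> int (added G) + 1" using j by (auto simp: vertices_def)
  have E1: "(\<lambda>e. interact (insert (int (added G) + 1) e) (add_vertex G)) -` ?E = {e. j \<in> e}"
    using j_old by (auto simp: vertex_weight_interact split: if_splits)
  have E2: "(\<lambda>T. interact T G) -` ?E = {T. j \<in> T}"
    by (auto simp: vertex_weight_interact split: if_splits)
  have "?w / size (triangles G) = ?w / Suc n" using G by (simp add: valid_def)
  then have tri: "measure_pmf.prob (pmf_of_multiset (triangles G)) {T. j \<in> T} = ?w / Suc n"
    using valid_sizes(2)[OF G] by (simp add: prob_pmf_of_multiset flip: vertex_weight_eq_size)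
  have edg: "measure_pmf.prob (pmf_of_multiset (edges G)) {T. j \<in> T} = 2 / 3 * ?w / Suc n"
    using valid_sizes(1,3,4)[OF G] by (simp add: prob_pmf_of_multiset field_simps)
  have uni2: "measure_pmf.prob (pmf_of_set (pairs (vertices G))) {T. j \<in> T} = 2 / ?v"
    using prob_uniform_subset_contains[OF vertices_finite j, of 1] by (simp add: pairs_def numeral_2_eq_2)
  have uni3: "measure_pmf.prob (pmf_of_set (triplets (vertices G))) {T. j \<in> T} = 3 / ?v"
    using prob_uniform_subset_contains[OF vertices_finite j, of 2] by (simp add: triplets_def numeral_3_eq_3)
  have step: "step p q r G = bind_pmf (bernoulli_pmf p) (\<lambda>new. if new
      then bind_pmf (bernoulli_pmf r) (\<lambda>b. map_pmf (\<lambda>e. interact (insert (int (added G) + 1) e) (add_vertex G))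
         (if b then pmf_of_multiset (edges G) else pmf_of_set (pairs (vertices G))))
      else bind_pmf (bernoulli_pmf q) (\<lambda>b. map_pmf (\<lambda>T. interact T G)
         (if b then pmf_of_multiset (triangles G) else pmf_of_set (triplets (vertices G)))))"
    unfolding step_def map_pmf_def ..
  have "measure_pmf.prob (step p q r G) ?E
      = p * (r * (2 / 3 * ?w / Suc n) + (1 - r) * (2 / ?v))
        + (1 - p) * (q * (?w / Suc n) + (1 - q) * (3 / ?v))"
    unfolding step using p q r
    by (simp only: prob_bernoulli_bind measure_map_pmf E1 E2 if_True if_False tri edg uni2 uni3)
  also have "\<dots> = \<alpha> p q r * ?w / Suc n + (p * (1 - r) * 2 + (1 - p) * (1 - q) * 3) / ?v"
    by (simp add: \<alpha>_def add_divide_distrib distrib_left distrib_right mult.assoc)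
  also have "\<dots> \<le> \<alpha> p q r * ?w / Suc n + 3 / ?v"
  proof -
    have "p * (1 - r) \<le> p * 1" "(1 - p) * (1 - q) \<le> (1 - p) * 1"
      using p q r by (intro mult_left_mono; simp)+
    then have "p * (1 - r) * 2 + (1 - p) * (1 - q) * 3 \<le> 3" using p by auto
    then show ?thesis by (intro add_left_mono divide_right_mono) auto
  qed
  finally show ?thesis by simp
qed

section \<open>The law of finite histories\<close>

text \<open>
  The law of \<open>(X 0, \<dots>, X n)\<close>. Histories are extended by the constant \<open>initial_graph\<close> beyond time \<open>n\<close>, so
  that equal histories up to time \<open>n\<close> are equal functions.
\<close>

primrec history :: "real \<Rightarrow> real \<Rightarrow> real \<Rightarrow> nat \<Rightarrow> (nat \<Rightarrow> wgraph) pmf" where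
  "history p q r 0 = return_pmf (\<lambda>_. initial_graph)"
| "history p q r (Suc n) =
     bind_pmf (history p q r n) (\<lambda>h. map_pmf (\<lambda>G. h(Suc n := G)) (step p q r (h n)))"

lemma history_default:
  "h \<in> set_pmf (history p q r n) \<Longrightarrow> n < i \<Longrightarrow> h i = initial_graph"
  by (induction n arbitrary: h) auto

lemma valid_history:
  "h \<in> set_pmf (history p q r n) \<Longrightarrow> i \<le> n \<Longrightarrow> valid i (h i)"
proof (induction n arbitrary: h i)
  case 0
  then show ?case by (simp add: valid_initial)
next
  case (Suc n)
  then obtain h' G where h': "h' \<in> set_pmf (history p q r n)" "G \<in> set_pmf (step p q r (h' n))"
    and h: "h = h'(Suc n := G)" by auto
  show ?case
  proof (cases "i = Suc n")
    case True
    then show ?thesis using valid_step[OF Suc.IH[OF h'(1) order.refl] h'(2)] h by simp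
  next
    case False
    then show ?thesis using Suc.IH[OF h'(1)] Suc.prems h by simp
  qed
qed

text \<open>
  An extended history determines both its beginning and its last graph, because the beginning
  has the default value at time \<open>n + 1\<close>; only one term of the mixture therefore contributes.
\<close>

lemma pmf_history_Suc:
  assumes "h (Suc n) = initial_graph"
  shows "pmf (history p q r (Suc n)) (h(Suc n := G)) = pmf (history p q r n) h * pmf (step p q r (h n)) G"
proof -
  let ?H = "history p q r n"
  have "pmf (map_pmf (\<lambda>G. h'(Suc n := G)) (step p q r (h' n))) (h(Suc n := G))
      = (if h' = h then pmf (step p q r (h n)) G else 0)" if h': "h' \<in> set_pmf ?H" for h'
  proof (cases "h' = h")
    case True
    have "inj (\<lambda>G. h(Suc n := G))" by (auto intro!: injI dest: fun_cong[of _ _ "Suc n"])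
    with True show ?thesis using pmf_map_inj'[of "\<lambda>G. h(Suc n := G)"] by simp
  next
    case False
    have "h' (Suc n) = h (Suc n)" using history_default[OF h'] assms by simp
    moreover obtain i where "h' i \<noteq> h i" using False by auto
    ultimately have "(h'(Suc n := G')) i \<noteq> (h(Suc n := G)) i" for G'
      by (cases "i = Suc n") auto
    then have "h(Suc n := G) \<noteq> h'(Suc n := G')" for G' by metis
    then have "h(Suc n := G) \<notin> set_pmf (map_pmf (\<lambda>G. h'(Suc n := G)) (step p q r (h' n)))"
      by auto
    with False show ?thesis by (simp add: pmf_eq_0_set_pmf)
  qed
  then have "pmf (history p q r (Suc n)) (h(Suc n := G))
      = (\<integral>h'. (if h' = h then pmf (step p q r (h n)) G else 0) \<partial>?H)"
    by (auto simp: pmf_bind intro!: integral_cong_AE AE_pmfI)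
  also have "\<dots> = (\<integral>h'. pmf (step p q r (h n)) G * indicator {h} h' \<partial>?H)"
    by (intro Bochner_Integration.integral_cong) auto
  finally show ?thesis by (simp add: measure_pmf_single)
qed

lemma prob_path_eq_pmf_history:
  assumes gp: "graph_process p q r M X" and h: "\<And>i. n < i \<Longrightarrow> h i = initial_graph"
  shows "measure M {\<omega> \<in> space M. \<forall>i\<le>n. X i \<omega> = h i} = pmf (history p q r n) h"
  using h
proof (induction n arbitrary: h)
  case 0
  interpret prob_space M using gp by (simp add: graph_process_def)
  have [measurable]: "X 0 \<in> measurable M (count_space UNIV)" and X0: "AE \<omega> in M. X 0 \<omega> = initial_graph"
    using gp by (auto simp: graph_process_def)
  show ?case
  proof (cases "h 0 = initial_graph")
    case True
    then have "h = (\<lambda>_. initial_graph)" using 0 by (metis bot_nat_0.not_eq_extremum ext)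
    moreover have "prob {\<omega> \<in> space M. X 0 \<omega> = initial_graph} = 1"
      by (subst prob_Collect_eq_1) (use X0 in auto)
    ultimately show ?thesis by simp
  next
    case False
    then have "h \<noteq> (\<lambda>_. initial_graph)" by auto
    moreover have "prob {\<omega> \<in> space M. X 0 \<omega> = h 0} = 0"
      by (subst prob_Collect_eq_0) (use X0 False in auto)
    ultimately show ?thesis by simp
  qed
next
  case (Suc n)
  define g where "g = h(Suc n := initial_graph)"
  have "g i = initial_graph" if "n < i" for i
    using that Suc.prems[of i] by (cases "i = Suc n") (auto simp: g_def)
  then have "measure M {\<omega> \<in> space M. \<forall>i\<le>n. X i \<omega> = g i} = pmf (history p q r n) g"
    by (rule Suc.IH)
  moreover have "(\<forall>i\<le>n. X i \<omega> = g i) \<longleftrightarrow> (\<forall>i\<le>n. X i \<omega> = h i)" for \<omega> by (auto simp: g_def)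
  moreover have "pmf (history p q r (Suc n)) (g(Suc n := h (Suc n)))
      = pmf (history p q r n) g * pmf (step p q r (g n)) (h (Suc n))"
    by (rule pmf_history_Suc) (simp add: g_def)
  ultimately show ?case using gp by (simp add: graph_process_def g_def)
qed

text \<open>
  Summing over the countably many possible histories inside an event shows that its probability under
  \<open>M\<close> is at least the one under \<open>history\<close>. The same bound for the complement gives
  equality.
\<close>

lemma prob_eq_history:
  assumes gp: "graph_process p q r M X"
    and Q: "\<And>h h'. (\<forall>i\<le>n. h i = h' i) \<Longrightarrow> Q h = Q h'"
    and meas: "{\<omega> \<in> space M. Q (\<lambda>i. X i \<omega>)} \<in> sets M"
  shows "measure M {\<omega> \<in> space M. Q (\<lambda>i. X i \<omega>)} = measure_pmf.prob (history p q r n) {h. Q h}"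
proof -
  interpret prob_space M using gp by (simp add: graph_process_def)
  have X[measurable]: "X i \<in> measurable M (count_space UNIV)" for i
    using gp by (auto simp: graph_process_def)
  let ?H = "history p q r n"
  have lower: "measure_pmf.prob ?H {h. P h} \<le> prob {\<omega> \<in> space M. P (\<lambda>i. X i \<omega>)}"
    if P: "\<And>h h'. (\<forall>i\<le>n. h i = h' i) \<Longrightarrow> P h = P h'"
      and meas_P: "{\<omega> \<in> space M. P (\<lambda>i. X i \<omega>)} \<in> sets M" for P
  proof -
    define S where "S = {h. P h} \<inter> set_pmf ?H"
    define E where "E h = {\<omega> \<in> space M. \<forall>i\<le>n. X i \<omega> = h i}" for h
    have S: "countable S" by (simp add: S_def)
    have E_meas: "E h \<in> sets M" for h unfolding E_def by measurable
    have disj: "disjoint_family_on E S"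
      unfolding disjoint_family_on_def
    proof (intro ballI impI)
      fix h h' assume hh: "h \<in> S" "h' \<in> S" "h \<noteq> h'"
      then obtain i where i: "h i \<noteq> h' i" by auto
      then have "i \<le> n" using history_default[of h p q r n i] history_default[of h' p q r n i] hh
        by (force simp: S_def)
      with i show "E h \<inter> E h' = {}" by (auto simp: E_def)
    qed
    have "emeasure ?H {h. P h} = emeasure ?H S"
      unfolding S_def by (simp add: emeasure_Int_set_pmf)
    also have "\<dots> = (\<integral>\<^sup>+h. pmf ?H h \<partial>count_space S)"
      by (simp add: nn_integral_pmf)
    also have "\<dots> = (\<integral>\<^sup>+h. emeasure M (E h) \<partial>count_space S)"
    proof (rule nn_integral_cong)
      fix h assume "h \<in> space (count_space S)"
      then have "h \<in> set_pmf ?H" by (simp add: S_def)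
      then have "prob (E h) = pmf ?H h"
        unfolding E_def using history_default by (intro prob_path_eq_pmf_history[OF gp]) blast
      then show "ennreal (pmf ?H h) = emeasure M (E h)" by (simp add: emeasure_eq_measure)
    qed
    also have "\<dots> = emeasure M (\<Union>h\<in>S. E h)"
      by (rule emeasure_UN_countable[symmetric]) (use E_meas S disj in auto)
    also have "\<dots> \<le> emeasure M {\<omega> \<in> space M. P (\<lambda>i. X i \<omega>)}"
    proof (rule emeasure_mono[OF _ meas_P])
      show "(\<Union>h\<in>S. E h) \<subseteq> {\<omega> \<in> space M. P (\<lambda>i. X i \<omega>)}"
      proof
        fix \<omega> assume "\<omega> \<in> (\<Union>h\<in>S. E h)"
        then obtain h where "P h" "\<omega> \<in> space M" "\<forall>i\<le>n. X i \<omega> = h i" by (auto simp: S_def E_def)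
        then show "\<omega> \<in> {\<omega> \<in> space M. P (\<lambda>i. X i \<omega>)}" using P[of "\<lambda>i. X i \<omega>" h] by simp
      qed
    qed
    finally show ?thesis by (simp add: emeasure_eq_measure measure_pmf.emeasure_eq_measure)
  qed
  have "{\<omega> \<in> space M. \<not> Q (\<lambda>i. X i \<omega>)} = space M - {\<omega> \<in> space M. Q (\<lambda>i. X i \<omega>)}" by auto
  then have "{\<omega> \<in> space M. \<not> Q (\<lambda>i. X i \<omega>)} \<in> sets M"
    and compl: "prob {\<omega> \<in> space M. \<not> Q (\<lambda>i. X i \<omega>)} = 1 - prob {\<omega> \<in> space M. Q (\<lambda>i. X i \<omega>)}"
    using meas prob_compl by auto
  moreover have "measure_pmf.prob ?H {h. \<not> Q h} = 1 - measure_pmf.prob ?H {h. Q h}"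
    using measure_pmf.prob_compl[of "{h. Q h}" ?H] by (simp add: Collect_neg_eq Compl_eq_Diff_UNIV)
  moreover have "measure_pmf.prob ?H {h. \<not> Q h} \<le> prob {\<omega> \<in> space M. \<not> Q (\<lambda>i. X i \<omega>)}"
    using Q calculation(1) by (intro lower) blast+
  moreover have "measure_pmf.prob ?H {h. Q h} \<le> prob {\<omega> \<in> space M. Q (\<lambda>i. X i \<omega>)}"
    using Q meas by (intro lower) blast+
  ultimately show ?thesis by linarith
qed

text \<open>
  Functionals of the whole history are allowed, so that a supermartingale can be stopped
  or killed at a random time.
\<close>

lemma history_supermartingale:
  assumes "\<And>n h. N \<le> n \<Longrightarrow> h \<in> set_pmf (history p q r n) \<Longrightarrow>
      (\<integral>\<^sup>+G. U (Suc n) (h(Suc n := G)) \<partial>step p q r (h n)) \<le> U n h"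
    and "N \<le> n"
  shows "(\<integral>\<^sup>+h. U n h \<partial>history p q r n) \<le> (\<integral>\<^sup>+h. U N h \<partial>history p q r N)"
  using assms(2)
proof (induction n rule: dec_induct)
  case (step n)
  have "(\<integral>\<^sup>+h. U (Suc n) h \<partial>history p q r (Suc n))
      = (\<integral>\<^sup>+h. (\<integral>\<^sup>+G. U (Suc n) (h(Suc n := G)) \<partial>step p q r (h n)) \<partial>history p q r n)"
    by simp
  also have "\<dots> \<le> (\<integral>\<^sup>+h. U n h \<partial>history p q r n)"
    using assms(1) step by (intro nn_integral_mono_AE AE_pmfI) auto
  finally show ?case using step by simp
qed simp

section \<open>Growth of the number of vertices\<close>

text \<open>
  The exponential moment behind the Chernoff bound: a vertex is added with probability \<open>p\<close>
  in every state, so each step multiplies the mean of \<open>(1/2) ^ added\<close> by \<open>1 - p + p/2\<close>.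
\<close>

lemma nn_integral_half_power_added_step:
  assumes "p \<in> {0..1}"
  shows "(\<integral>\<^sup>+G'. ennreal ((1/2) ^ added G') \<partial>step p q r G) = ennreal ((1/2) ^ added G * (1 - p/2))"
proof -
  have "(\<integral>\<^sup>+G'. ennreal ((1/2) ^ added G') \<partial>step p q r G)
      = ennreal ((1/2) ^ Suc (added G)) * ennreal p + ennreal ((1/2) ^ added G) * ennreal (1 - p)"
    unfolding step_def using assms by simp
  also have "\<dots> = ennreal ((1/2) ^ Suc (added G) * p + (1/2) ^ added G * (1 - p))"
    using assms by (simp del: power_Suc flip: ennreal_mult ennreal_plus)
  also have "(1/2) ^ Suc (added G) * p + (1/2) ^ added G * (1 - p) = (1/2) ^ added G * (1 - p/2)"
    by (simp add: algebra_simps)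
  finally show ?thesis .
qed

lemma nn_integral_half_power_added:
  assumes "p \<in> {0..1}"
  shows "(\<integral>\<^sup>+h. ennreal ((1/2) ^ added (h n)) \<partial>history p q r n) = ennreal ((1 - p/2) ^ n)"
proof (induction n)
  case 0
  then show ?case by (simp add: initial_graph_def)
next
  case (Suc n)
  have "(\<integral>\<^sup>+h. ennreal ((1/2) ^ added (h (Suc n))) \<partial>history p q r (Suc n))
      = (\<integral>\<^sup>+h. ennreal ((1/2) ^ added (h n)) * ennreal (1 - p/2) \<partial>history p q r n)"
    using assms by (simp add: nn_integral_half_power_added_step ennreal_mult)
  also have "\<dots> = ennreal ((1 - p/2) ^ n) * ennreal (1 - p/2)"
    by (simp add: nn_integral_multc Suc)
  also have "\<dots> = ennreal ((1 - p/2) ^ Suc n)"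
    using assms by (simp add: mult.commute flip: ennreal_mult)
  finally show ?case .
qed

lemma AE_linearly_many_vertices:
  assumes p: "0 < p" "p \<le> 1" and gp: "graph_process p q r M X"
  obtains c where "0 < c" "AE \<omega> in M. \<forall>\<^sub>F n in sequentially. c * real n \<le> real (added (X n \<omega>))"
proof -
  interpret prob_space M using gp by (simp add: graph_process_def)
  have X[measurable]: "X i \<in> measurable M (count_space UNIV)" for i
    using gp by (auto simp: graph_process_def)
  define b where "b = 1 - p/2"
  have b: "0 < b" "b < 1" using p by (auto simp: b_def)
  \<comment> \<open>Any \<open>c\<close> with \<open>2 powr c * b < 1\<close> works; this choice makes the product equal to \<open>sqrt b\<close>.\<close>
  define c where "c = log 2 (1/b) / 2"
  have c: "0 < c" unfolding c_def using b by (simp add: zero_less_log_cancel_iff)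
  have cb: "2 powr c = 1 / sqrt b"
  proof -
    have "2 powr c = (2 powr log 2 (1/b)) powr (1/2)" by (simp only: c_def powr_powr) simp
    also have "\<dots> = sqrt (1/b)" using b by (simp add: powr_half_sqrt)
    finally show ?thesis by (simp add: real_sqrt_divide)
  qed
  define A where "A n = {\<omega> \<in> space M. real (added (X n \<omega>)) < c * real n}" for n
  have A_meas: "A n \<in> sets M" for n unfolding A_def by measurable
  have "prob (A n) \<le> sqrt b ^ n" for n
  proof -
    let ?H = "history p q r n"
    have "prob (A n) = measure_pmf.prob ?H {h. real (added (h n)) < c * real n}"
      unfolding A_def
      by (rule prob_eq_history[OF gp, where Q = "\<lambda>h. real (added (h n)) < c * real n"])
        (use A_meas in \<open>auto simp: A_def\<close>)
    also have "ennreal \<dots> = (\<integral>\<^sup>+h. indicator {h. real (added (h n)) < c * real n} h \<partial>?H)"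
      by (simp add: measure_pmf.emeasure_eq_measure)
    also have "\<dots> \<le> (\<integral>\<^sup>+h. ennreal ((2 powr c) ^ n) * ennreal ((1/2) ^ added (h n)) \<partial>?H)"
    proof (rule nn_integral_mono)
      fix h :: "nat \<Rightarrow> wgraph"
      show "indicator {h. real (added (h n)) < c * real n} h
          \<le> ennreal ((2 powr c) ^ n) * ennreal ((1/2) ^ added (h n))"
      proof (cases "real (added (h n)) < c * real n")
        case True
        have "(1::real) = 2 powr real (added (h n)) * (1/2) ^ added (h n)"
          by (simp add: powr_realpow power_divide)
        also have "\<dots> \<le> 2 powr (c * real n) * (1/2) ^ added (h n)"
          using True by (intro mult_right_mono) auto
        also have "2 powr (c * real n) = (2 powr c) ^ n"
          by (simp add: powr_powr flip: powr_realpow)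
        finally have "1 \<le> (2 powr c) ^ n * (1/2) ^ added (h n)" .
        then show ?thesis using True by (simp flip: ennreal_mult)
      qed simp
    qed
    also have "\<dots> = ennreal ((2 powr c) ^ n) * ennreal (b ^ n)"
      using p by (simp add: nn_integral_cmult nn_integral_half_power_added b_def)
    also have "\<dots> = ennreal (sqrt b ^ n)"
    proof -
      have "2 powr c * b = sqrt b" using b by (simp add: cb real_div_sqrt)
      then have "(2 powr c) ^ n * b ^ n = sqrt b ^ n"
        by (simp flip: power_mult_distrib)
      then show ?thesis using b by (simp flip: ennreal_mult)
    qed
    finally show ?thesis using b by (subst (asm) ennreal_le_iff) auto
  qed
  moreover have "summable (\<lambda>n. sqrt b ^ n)"
    using b by (intro summable_geometric) auto
  ultimately have "summable (\<lambda>n. prob (A n))"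
    by - (rule summable_comparison_test'[where g = "\<lambda>n. sqrt b ^ n" and N = 0], simp_all)
  then have "AE \<omega> in M. \<forall>\<^sub>F n in sequentially. \<omega> \<in> space M - A n"
    using A_meas by (intro borel_cantelli_AE1) (auto simp: emeasure_eq_measure)
  then have "AE \<omega> in M. \<forall>\<^sub>F n in sequentially. c * real n \<le> real (added (X n \<omega>))"
    by (rule AE_mp) (auto intro!: AE_I2 elim!: eventually_mono simp: A_def)
  with c show thesis by (rule that)
qed

section \<open>The weight of young vertices\<close>

lemma AE_valid:
  assumes gp: "graph_process p q r M X"
  shows "AE \<omega> in M. \<forall>n. valid n (X n \<omega>)"
  unfolding AE_all_countable
proof
  fix n
  interpret prob_space M using gp by (simp add: graph_process_def)
  have X[measurable]: "X i \<in> measurable M (count_space UNIV)" for i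
    using gp by (auto simp: graph_process_def)
  have [measurable]: "Measurable.pred M (\<lambda>\<omega>. valid n (X n \<omega>))"
    by (rule measurable_compose[OF X]) simp
  have meas: "{\<omega> \<in> space M. valid n (X n \<omega>)} \<in> events" by measurable
  have "prob {\<omega> \<in> space M. valid n (X n \<omega>)} = measure_pmf.prob (history p q r n) {h. valid n (h n)}"
    by (rule prob_eq_history[OF gp, where Q = "\<lambda>h. valid n (h n)"]) (use meas in simp_all)
  also have "\<dots> = 1"
    using valid_history[of _ p q r n n] by (simp add: measure_pmf.prob_eq_1 AE_measure_pmf_iff)
  finally show "AE \<omega> in M. valid n (X n \<omega>)" using meas by (subst (asm) prob_Collect_eq_1) auto
qed

text \<open>
  Doob's maximal inequality for a process \<open>\<phi> n (X n)\<close> that is known to be a supermartingale only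
  while the states satisfy \<open>A\<close>. It is stopped with value \<open>l\<close> when it first reaches the level \<open>l\<close>, and
  killed with value zero when \<open>A\<close> first fails; the resulting functional \<open>U\<close> of the history is a
  supermartingale that dominates \<open>l\<close> times the indicator of the event.
\<close>

lemma maximal_inequality:
  fixes \<phi> :: "nat \<Rightarrow> wgraph \<Rightarrow> real" and A :: "nat \<Rightarrow> wgraph \<Rightarrow> bool"
  assumes gp: "graph_process p q r M X" and l: "0 < l"
    and super: "\<And>n G. N \<le> n \<Longrightarrow> valid n G \<Longrightarrow> A n G \<Longrightarrow>
      (\<integral>\<^sup>+G'. ennreal (\<phi> (Suc n) G') \<partial>step p q r G) \<le> ennreal (\<phi> n G)"
    and init: "\<And>G. valid N G \<Longrightarrow> \<phi> N G \<le> B" and B: "0 \<le> B"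
  shows "measure M {\<omega> \<in> space M. \<exists>m\<ge>N. l \<le> \<phi> m (X m \<omega>) \<and> (\<forall>i\<in>{N..<m}. A i (X i \<omega>))} \<le> B / l"
proof -
  interpret prob_space M using gp by (simp add: graph_process_def)
  have X[measurable]: "X i \<in> measurable M (count_space UNIV)" for i
    using gp by (auto simp: graph_process_def)
  define hit where "hit n h \<longleftrightarrow> (\<exists>m\<in>{N..n}. l \<le> \<phi> m (h m) \<and> (\<forall>i\<in>{N..<m}. A i (h i)))"
    for n and h :: "nat \<Rightarrow> wgraph"
  define U where "U n h = (if hit n h then ennreal l else if \<forall>i\<in>{N..<n}. A i (h i) then ennreal (\<phi> n (h n)) else 0)"
    for n and h :: "nat \<Rightarrow> wgraph"
  have hit_cong: "hit n h = hit n h'" if "\<forall>i\<le>n. h i = h' i" for n h h'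
    unfolding hit_def using that by (intro bex_cong) auto
  have hit_Suc: "hit (Suc n) (h(Suc n := G)) \<longleftrightarrow>
      hit n h \<or> (l \<le> \<phi> (Suc n) G \<and> (\<forall>i\<in>{N..<Suc n}. A i (h i)))" if "N \<le> n" for n h G
  proof -
    have "hit (Suc n) (h(Suc n := G)) \<longleftrightarrow> hit n (h(Suc n := G)) \<or>
        (l \<le> \<phi> (Suc n) G \<and> (\<forall>i\<in>{N..<Suc n}. A i ((h(Suc n := G)) i)))"
      unfolding hit_def using that by (auto simp: atLeastAtMostSuc_conv)
    also have "hit n (h(Suc n := G)) = hit n h" by (rule hit_cong) auto
    also have "(\<forall>i\<in>{N..<Suc n}. A i ((h(Suc n := G)) i)) = (\<forall>i\<in>{N..<Suc n}. A i (h i))"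
      by (intro ball_cong) auto
    finally show ?thesis .
  qed
  have U_super: "(\<integral>\<^sup>+G. U (Suc n) (h(Suc n := G)) \<partial>step p q r (h n)) \<le> U n h"
    if n: "N \<le> n" and h: "h \<in> set_pmf (history p q r n)" for n h
  proof -
    have alive: "(\<forall>i\<in>{N..<Suc n}. A i ((h(Suc n := G)) i)) = (\<forall>i\<in>{N..<Suc n}. A i (h i))" for G
      by (intro ball_cong) auto
    \<comment> \<open>At a first hit the level \<open>l\<close> is at most \<open>\<phi> (Suc n) G\<close>, which the minimum expresses.\<close>
    have U_Suc: "U (Suc n) (h(Suc n := G)) = (if hit n h then ennreal l
        else if \<forall>i\<in>{N..<Suc n}. A i (h i) then ennreal (min l (\<phi> (Suc n) G)) else 0)" for G
      unfolding U_def hit_Suc[OF n] alive by (auto simp: min_def)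
    show ?thesis
    proof (cases "hit n h \<or> \<not> (\<forall>i\<in>{N..<Suc n}. A i (h i))")
      case True
      then show ?thesis
      proof (cases "hit n h")
        case dead: False
        with True have "\<not> (\<forall>i\<in>{N..<Suc n}. A i (h i))" by simp
        with dead show ?thesis by (simp only: U_Suc if_False) simp
      qed (simp only: U_Suc if_True, simp add: U_def)
    next
      case False
      then have "(\<integral>\<^sup>+G. U (Suc n) (h(Suc n := G)) \<partial>step p q r (h n))
          \<le> (\<integral>\<^sup>+G. ennreal (\<phi> (Suc n) G) \<partial>step p q r (h n))"
        unfolding U_Suc by (intro nn_integral_mono) (auto intro!: ennreal_leI)
      also have "\<dots> \<le> ennreal (\<phi> n (h n))"
        using False n valid_history[OF h] by (intro super) auto
      also have "\<dots> = U n h" using False by (auto simp: U_def)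
      finally show ?thesis .
    qed
  qed
  have U_init: "U N h \<le> ennreal B" if "h \<in> set_pmf (history p q r N)" for h
    using init[OF valid_history[OF that order.refl]] B unfolding U_def hit_def
    by (auto intro!: ennreal_leI)
  define E where "E n = {\<omega> \<in> space M. hit n (\<lambda>i. X i \<omega>)}" for n
  have [measurable]: "(\<lambda>\<omega>. \<phi> m (X m \<omega>)) \<in> borel_measurable M" "Measurable.pred M (\<lambda>\<omega>. A m (X m \<omega>))" for m
    by (rule measurable_compose[OF X]; simp)+
  have E_meas: "E n \<in> sets M" for n
    unfolding E_def hit_def by measurable
  have prob_E: "prob (E n) \<le> B / l" if n: "N \<le> n" for n
  proof -
    let ?H = "history p q r n"
    have "prob (E n) = measure_pmf.prob ?H {h. hit n h}"
      unfolding E_def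
    proof (rule prob_eq_history[OF gp, where Q = "hit n"])
      show "{\<omega> \<in> space M. hit n (\<lambda>i. X i \<omega>)} \<in> events" using E_meas by (simp add: E_def)
    qed (rule hit_cong)
    then have "ennreal (l * prob (E n)) = (\<integral>\<^sup>+h. ennreal l * indicator {h. hit n h} h \<partial>?H)"
      using l by (simp add: measure_pmf.emeasure_eq_measure ennreal_mult nn_integral_cmult_indicator)
    also have "\<dots> \<le> (\<integral>\<^sup>+h. U n h \<partial>?H)"
      by (intro nn_integral_mono) (auto simp: U_def)
    also have "\<dots> \<le> (\<integral>\<^sup>+h. U N h \<partial>history p q r N)"
      by (rule history_supermartingale[OF U_super n])
    also have "\<dots> \<le> (\<integral>\<^sup>+h. ennreal B \<partial>history p q r N)"
      by (intro nn_integral_mono_AE AE_pmfI U_init)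
    finally have "l * prob (E n) \<le> B" using B by simp
    then show ?thesis using l by (simp add: field_simps)
  qed
  have "incseq E" unfolding E_def hit_def by (intro incseq_SucI) auto
  then have "(\<lambda>n. prob (E n)) \<longlonglongrightarrow> prob (\<Union>n. E n)"
    using E_meas by (intro finite_Lim_measure_incseq) auto
  then have "prob (\<Union>n. E n) \<le> B / l"
    by (rule LIMSEQ_le_const2) (use prob_E in blast)
  also have "(\<Union>n. E n) = {\<omega> \<in> space M. \<exists>m\<ge>N. l \<le> \<phi> m (X m \<omega>) \<and> (\<forall>i\<in>{N..<m}. A i (X i \<omega>))}"
    unfolding E_def hit_def by fastforce
  finally show ?thesis .
qed

text \<open>
  Bernoulli's inequality with a real exponent makes \<open>n powr s\<close> itself, instead of a product of factors
  \<open>1 + s / i\<close>, a sufficient normalization of the supermartingale.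
\<close>

lemma powr_Bernoulli:
  fixes s x :: real
  assumes "1 \<le> s" "0 \<le> x"
  shows "1 + s * x \<le> (1 + x) powr s"
proof -
  have "(1 + 0) powr s - s * 0 \<le> (1 + x) powr s - s * x"
  proof (rule DERIV_nonneg_imp_nondecreasing[OF assms(2)])
    fix y :: real assume y: "0 \<le> y" "y \<le> x"
    have "((\<lambda>y. (1 + y) powr s - s * y) has_real_derivative s * (1 + y) powr (s - 1) - s) (at y)"
      using y by (auto intro!: derivative_eq_intros simp: powr_diff)
    moreover have "s * (1 + y) powr (s - 1) \<ge> s * 1"
      using assms y by (intro mult_left_mono ge_one_powr_ge_zero) auto
    ultimately show "\<exists>d. ((\<lambda>y. (1 + y) powr s - s * y) has_real_derivative d) (at y) \<and> 0 \<le> d"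
      by force
  qed
  then show ?thesis by simp
qed

text \<open>
  The normalized rising factorial of the shifted weight of vertex \<open>j\<close>. Before \<open>j\<close> is born the value is
  the one that it would take at birth at time \<open>j\<close>; a later birth gives a smaller value, which
  keeps the supermartingale inequality at the birth of \<open>j\<close>.
\<close>

definition potential :: "real \<Rightarrow> nat \<Rightarrow> real \<Rightarrow> nat \<Rightarrow> nat \<Rightarrow> wgraph \<Rightarrow> real" where
  "potential s k a j n G =
     (if j \<le> added G then pochhammer (real (vertex_weight G (int j)) + a) k / real n powr s
      else pochhammer (1 + a) k / real j powr s)"

lemma pochhammer_mono_base:
  fixes x y :: real
  assumes "0 < x" "x \<le> y"
  shows "pochhammer x k \<le> pochhammer y k"
  unfolding pochhammer_prod using assms by (intro prod_mono) auto

lemma power_le_pochhammer: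
  fixes x y :: real
  assumes "0 \<le> x" "x \<le> y"
  shows "x ^ k \<le> pochhammer y k"
proof -
  have "x ^ k = (\<Prod>i = 0..<k. x)" by simp
  also have "\<dots> \<le> pochhammer y k"
    unfolding pochhammer_prod using assms by (intro prod_mono) auto
  finally show ?thesis .
qed

lemma pochhammer_increment:
  fixes y :: real
  shows "(pochhammer (y + 1) k - pochhammer y k) * y = real k * pochhammer y k"
proof -
  have "pochhammer (y + 1) k * y = (y + real k) * pochhammer y k"
    using pochhammer_rec[of y k] pochhammer_rec'[of y k] by (simp add: mult.commute)
  then show ?thesis by (simp add: algebra_simps)
qed

text \<open>
  The discrete analogue of the derivative of \<open>y ^ k\<close>: the increment of the rising factorial is
  exactly \<open>k / y\<close> times its value, and \<open>P\<close>, the probability of an increment, is at most a multiple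
  of \<open>y\<close>. The two factors \<open>y\<close> cancel.
\<close>

lemma pochhammer_growth:
  fixes y P b :: real
  assumes y: "0 < y" and n: "1 \<le> n" and s: "1 \<le> b * real k"
    and P: "P \<le> b * y / real n"
  shows "(pochhammer y k + (pochhammer (y + 1) k - pochhammer y k) * P) / real (Suc n) powr (b * real k)
       \<le> pochhammer y k / real n powr (b * real k)"
proof -
  let ?s = "b * real k" and ?Z = "pochhammer y k"
  have Z: "0 < ?Z" using y by (rule pochhammer_pos)
  have D: "0 \<le> pochhammer (y + 1) k - ?Z" using y pochhammer_mono_base[of y "y + 1" k] by simp
  have "?Z + (pochhammer (y + 1) k - ?Z) * P
      \<le> ?Z + (pochhammer (y + 1) k - ?Z) * (b * y / real n)"
    using mult_left_mono[OF P D] by simp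
  also have "(pochhammer (y + 1) k - ?Z) * (b * y / real n)
      = b / real n * ((pochhammer (y + 1) k - ?Z) * y)" by simp
  also have "\<dots> = b / real n * (real k * ?Z)" by (simp only: pochhammer_increment)
  also have "?Z + \<dots> = ?Z * (1 + ?s * (1 / real n))" by (simp add: algebra_simps)
  also have "\<dots> \<le> ?Z * (1 + 1 / real n) powr ?s"
    using Z s by (intro mult_left_mono powr_Bernoulli) auto
  also have "1 + 1 / real n = real (Suc n) / real n" using n by (simp add: field_simps)
  also have "(real (Suc n) / real n) powr ?s = real (Suc n) powr ?s / real n powr ?s"
    by (simp add: powr_divide)
  finally show ?thesis by (simp add: divide_le_eq)
qed

text \<open>
  The shift \<open>a\<close> absorbs the uniform rules: \<open>3 / (c * n) = \<alpha> * a / n\<close>, so that the bound on the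
  probability of an interaction becomes proportional to the shifted weight.
\<close>

lemma potential_supermartingale:
  assumes p: "p \<in> {0..1}" and q: "q \<in> {0..1}" and r: "r \<in> {0..1}"
    and al: "0 < \<alpha> p q r" and s: "1 \<le> \<alpha> p q r * real k"
    and c: "0 < c" "c * real n \<le> real (added G)" and n: "1 \<le> n" and j: "1 \<le> j"
    and G: "valid n G"
  defines "a \<equiv> 3 / (c * \<alpha> p q r)"
  shows "(\<integral>\<^sup>+G'. ennreal (potential (\<alpha> p q r * real k) k a j (Suc n) G') \<partial>step p q r G)
       \<le> ennreal (potential (\<alpha> p q r * real k) k a j n G)"
proof -
  let ?s = "\<alpha> p q r * real k" and ?w = "vertex_weight G (int j)"
  let ?S = "step p q r G"
  have a: "0 < a" unfolding a_def using al c by simp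
  have mono: "added G \<le> added G'" "added G' \<le> Suc (added G)"
    "?w \<le> vertex_weight G' (int j)" "vertex_weight G' (int j) \<le> Suc ?w"
    if "G' \<in> set_pmf ?S" for G'
    using set_pmf_step[OF G that] by (cases; auto simp: vertex_weight_interact)+
  show ?thesis
  proof (cases "j \<le> added G")
    case True
    let ?E = "{G'. vertex_weight G' (int j) = Suc ?w}"
    define y where "y = real ?w + a"
    have y: "0 < y" using a by (simp add: y_def)
    define D where "D = pochhammer (y + 1) k - pochhammer y k"
    have D: "0 \<le> D" unfolding D_def using y pochhammer_mono_base[of y "y + 1" k] by simp
    have Z: "0 < pochhammer y k" using y by (rule pochhammer_pos)
    have pot: "potential ?s k a j (Suc n) G'
        = pochhammer y k / real (Suc n) powr ?s + D / real (Suc n) powr ?s * indicator ?E G'"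
      if G': "G' \<in> set_pmf ?S" for G'
    proof (cases "G' \<in> ?E")
      case True
      with \<open>j \<le> added G\<close> mono[OF G'] show ?thesis
        by (simp add: potential_def D_def y_def diff_divide_distrib add_ac)
    next
      case False
      then have "vertex_weight G' (int j) = ?w" using mono[OF G'] by simp
      with \<open>j \<le> added G\<close> mono[OF G'] False show ?thesis by (simp add: potential_def y_def)
    qed
    have "(\<integral>\<^sup>+G'. ennreal (potential ?s k a j (Suc n) G') \<partial>?S)
        = (\<integral>\<^sup>+G'. ennreal (pochhammer y k / real (Suc n) powr ?s)
             + ennreal (D / real (Suc n) powr ?s) * indicator ?E G' \<partial>?S)"
      using D Z by (intro nn_integral_cong_AE AE_pmfI) (auto simp: pot indicator_def ennreal_plus)
    also have "\<dots> = ennreal (pochhammer y k / real (Suc n) powr ?s)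
        + ennreal (D / real (Suc n) powr ?s) * emeasure ?S ?E"
      by (simp add: nn_integral_add nn_integral_cmult_indicator)
    also have "\<dots> = ennreal ((pochhammer y k + D * measure_pmf.prob ?S ?E) / real (Suc n) powr ?s)"
      using D Z by (simp add: measure_pmf.emeasure_eq_measure add_divide_distrib
          flip: ennreal_mult ennreal_plus)
    also have "\<dots> \<le> ennreal (pochhammer y k / real n powr ?s)"
      unfolding D_def
    proof (intro ennreal_leI pochhammer_growth[OF y n s])
      have "int j \<in> vertices G" using True by (simp add: vertices_def)
      then have "measure_pmf.prob ?S ?E \<le> \<alpha> p q r * ?w / Suc n + 3 / (added G + 3)"
        by (rule prob_interaction_le[OF p q r G])
      also have "\<dots> \<le> \<alpha> p q r * ?w / n + 3 / (c * n)"
        using al c n by (intro add_mono divide_left_mono) auto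
      also have "\<dots> = \<alpha> p q r * y / n"
        using al c n by (simp add: y_def a_def field_simps)
      finally show "measure_pmf.prob ?S ?E \<le> \<alpha> p q r * y / n" .
    qed
    also have "pochhammer y k / real n powr ?s = potential ?s k a j n G"
      using True by (simp add: potential_def y_def)
    finally show ?thesis .
  next
    case False
    have unborn: "?w = 0" using False by (intro vertex_weight_unborn[OF G]) simp
    have "potential ?s k a j (Suc n) G' \<le> pochhammer (1 + a) k / real j powr ?s"
      if G': "G' \<in> set_pmf ?S" for G'
    proof (cases "j \<le> added G'")
      case True
      have "j = Suc (added G)" using True False mono[OF G'] by simp
      then have "real j \<le> real (Suc n)" using G by (simp add: valid_def)
      then have "real j powr ?s \<le> real (Suc n) powr ?s" using s by (intro powr_mono2) auto
      moreover have "pochhammer (real (vertex_weight G' (int j)) + a) k \<le> pochhammer (1 + a) k"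
        using mono[OF G'] unborn a by (intro pochhammer_mono_base) auto
      moreover have "0 < pochhammer (1 + a) k" using a by (intro pochhammer_pos) simp
      ultimately show ?thesis
        using True j by (auto simp: potential_def intro!: frac_le)
    qed (simp add: potential_def)
    then have "(\<integral>\<^sup>+G'. ennreal (potential ?s k a j (Suc n) G') \<partial>?S)
        \<le> (\<integral>\<^sup>+G'. ennreal (pochhammer (1 + a) k / real j powr ?s) \<partial>?S)"
      by (intro nn_integral_mono_AE AE_pmfI ennreal_leI)
    also have "\<dots> = ennreal (potential ?s k a j n G)" using False by (simp add: potential_def)
    finally show ?thesis .
  qed
qed

text \<open>
  The exponent \<open>k\<close> is chosen so large that \<open>\<alpha> * k > 1\<close>, which makes the maximal inequality at level
  \<open>e ^ k\<close> summable over the vertices \<open>j\<close>. The restriction to \<open>j > N\<close> there ensures that \<open>j\<close> is not yet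
  born at time \<open>N\<close>, from which on there are enough vertices.
\<close>

lemma AE_young_vertices_small:
  assumes p: "p \<in> {0..1}" and q: "q \<in> {0..1}" and r: "r \<in> {0..1}"
    and gp: "graph_process p q r M X" and al: "0 < \<alpha> p q r" and c: "0 < c"
    and e: "0 < e" and N: "1 \<le> N"
  shows "AE \<omega> in M. (\<forall>n\<ge>N. c * real n \<le> real (added (X n \<omega>))) \<longrightarrow>
    (\<forall>\<^sub>F j in sequentially. \<forall>n\<ge>N. real (vertex_weight (X n \<omega>) (int j)) < e * real n powr \<alpha> p q r)"
proof -
  interpret prob_space M using gp by (simp add: graph_process_def)
  have X: "X i \<in> measurable M (count_space UNIV)" for i
    using gp by (auto simp: graph_process_def)
  obtain k :: nat where k: "1 < \<alpha> p q r * real k"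
    using reals_Archimedean3[OF al] by (metis mult.commute)
  let ?s = "\<alpha> p q r * real k"
  define a where "a = 3 / (c * \<alpha> p q r)"
  have a: "0 < a" unfolding a_def using al c by simp
  define C where "C = pochhammer (1 + a) k"
  have C: "0 < C" unfolding C_def using a by (intro pochhammer_pos) simp
  define A :: "nat \<Rightarrow> wgraph \<Rightarrow> bool" where "A n G \<longleftrightarrow> c * real n \<le> real (added G)" for n G
  define E where "E j = {\<omega> \<in> space M. \<exists>m\<ge>N. e ^ k \<le> potential ?s k a j m (X m \<omega>) \<and>
      (\<forall>i\<in>{N..<m}. A i (X i \<omega>))}" for j
  have [measurable]: "(\<lambda>\<omega>. potential ?s k a j m (X m \<omega>)) \<in> borel_measurable M"
    "Measurable.pred M (\<lambda>\<omega>. A m (X m \<omega>))" for j m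
    by (rule measurable_compose[OF X]; simp)+
  have E_meas: "E j \<in> events" for j unfolding E_def by measurable
  have "prob (E j) \<le> C / e ^ k * real j powr (- ?s)" if j: "N < j" for j
  proof -
    have "prob (E j) \<le> (C / real j powr ?s) / e ^ k"
      unfolding E_def
    proof (rule maximal_inequality[OF gp])
      fix n G assume "N \<le> n" "valid n G" "A n G"
      then show "(\<integral>\<^sup>+G'. ennreal (potential ?s k a j (Suc n) G') \<partial>step p q r G)
          \<le> ennreal (potential ?s k a j n G)"
        unfolding a_def using p q r al k c N j
        by (intro potential_supermartingale) (auto simp: A_def)
    next
      fix G assume "valid N G"
      then show "potential ?s k a j N G \<le> C / real j powr ?s"
        using j by (simp add: potential_def valid_def C_def)
    qed (use e C in auto)
    then show ?thesis by (simp add: powr_minus field_simps)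
  qed
  moreover have "summable (\<lambda>j. C / e ^ k * real j powr (- ?s))"
    using k by (intro summable_mult) (simp add: summable_real_powr_iff)
  ultimately have "summable (\<lambda>j. prob (E j))"
    by - (rule summable_comparison_test'[where N = "Suc N" and g = "\<lambda>j. C / e ^ k * real j powr (- ?s)"], simp_all)
  then have "AE \<omega> in M. \<forall>\<^sub>F j in sequentially. \<omega> \<in> space M - E j"
    using E_meas by (intro borel_cantelli_AE1) (auto simp: emeasure_eq_measure)
  with AE_valid[OF gp] show ?thesis
  proof eventually_elim
    case (elim \<omega>)
    show ?case
    proof
      assume good: "\<forall>n\<ge>N. c * real n \<le> real (added (X n \<omega>))"
      from elim(2) show "\<forall>\<^sub>F j in sequentially. \<forall>n\<ge>N.
          real (vertex_weight (X n \<omega>) (int j)) < e * real n powr \<alpha> p q r"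
      proof (rule eventually_mono)
        fix j assume j: "\<omega> \<in> space M - E j"
        show "\<forall>n\<ge>N. real (vertex_weight (X n \<omega>) (int j)) < e * real n powr \<alpha> p q r"
        proof (intro allI impI, rule ccontr)
          fix n assume n: "N \<le> n"
          let ?w = "real (vertex_weight (X n \<omega>) (int j))"
          assume "\<not> ?w < e * real n powr \<alpha> p q r"
          then have big: "e * real n powr \<alpha> p q r \<le> ?w" by simp
          have pos: "0 < e * real n powr \<alpha> p q r" using e n N by simp
          then have "vertex_weight (X n \<omega>) (int j) \<noteq> 0" using big by auto
          then have born: "j \<le> added (X n \<omega>)"
            using vertex_weight_unborn[of n "X n \<omega>" "int j"] elim(1) by force
          have "e ^ k * real n powr ?s = (e * real n powr \<alpha> p q r) ^ k"
            using n N by (simp add: power_mult_distrib powr_power mult.commute)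
          also have "\<dots> \<le> ?w ^ k" using big pos by (intro power_mono) auto
          also have "\<dots> \<le> pochhammer (?w + a) k" using a by (intro power_le_pochhammer) auto
          finally have "e ^ k \<le> potential ?s k a j n (X n \<omega>)"
            using born n N by (simp add: potential_def pos_le_divide_eq)
          then have "\<omega> \<in> E j" using j n good by (auto simp: E_def A_def)
          with j show False by simp
        qed
      qed
    qed
  qed
qed

section \<open>The maximal weight\<close>

text \<open>
  Smallness with \<open>e = 1\<close> bounds all but finitely many limits and so makes the supremum \<open>m\<close> finite.
  Smallness with \<open>e = m / 2\<close> then shows that eventually only finitely many fixed columns compete for the
  maximum, and those converge.
\<close>

lemma max_asymptotics_of_columns:
  fixes w :: "nat \<Rightarrow> int \<Rightarrow> nat" and z :: "int \<Rightarrow> real" and a :: real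
  assumes lim: "\<And>j. -2 \<le> j \<Longrightarrow> (\<lambda>n. real n powr (- a) * real (w n j)) \<longlonglongrightarrow> z j"
    and pos: "\<And>j. -2 \<le> j \<Longrightarrow> 0 < z j"
    and small: "\<And>e. 0 < e \<Longrightarrow> \<exists>J N. \<forall>j\<ge>J. \<forall>n\<ge>N. real (w n (int j)) \<le> e * real n powr a"
  defines "m \<equiv> (SUP j\<in>{-2..}. ereal (z j))"
  shows "0 < m" "m < \<infinity>"
    and "(\<lambda>n. real (Max (w n ` {-2..int n})) / (real_of_ereal m * real n powr a)) \<longlonglongrightarrow> 1"
proof -
  have z_le: "ereal (z j) \<le> m" if "-2 \<le> j" for j
    unfolding m_def using that by (intro SUP_upper) auto
  have "0 < ereal (z 0)" using pos by simp
  then show m_pos: "0 < m" using z_le[of 0] by (rule less_le_trans) simp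
  obtain J1 N1 where J1: "\<forall>j\<ge>J1. \<forall>n\<ge>N1. real (w n (int j)) \<le> 1 * real n powr a"
    using small[of 1] by auto
  have z_tail: "z j \<le> 1" if "int J1 \<le> j" for j
  proof (rule tendsto_upperbound[OF lim])
    have "real n powr (- a) * real (w n j) \<le> 1" if n: "n \<ge> max 1 N1" for n
      using J1[rule_format, of "nat j" n] \<open>int J1 \<le> j\<close> n
      by (simp add: powr_minus field_simps)
    then show "\<forall>\<^sub>F n in sequentially. real n powr (- a) * real (w n j) \<le> 1"
      unfolding eventually_sequentially by blast
  qed (use that in auto)
  define b where "b = Max (insert 1 (z ` {-2..int J1}))"
  have "z j \<le> b" if "-2 \<le> j" for j
  proof (cases "j \<le> int J1")
    case True
    then show ?thesis unfolding b_def using that by (intro Max_ge) auto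
  next
    case False
    then have "z j \<le> 1" using z_tail by simp
    also have "1 \<le> b" unfolding b_def by (intro Max_ge) auto
    finally show ?thesis .
  qed
  then have "m \<le> ereal b" unfolding m_def by (intro SUP_least) auto
  then show m_fin: "m < \<infinity>" by auto
  define \<nu> where "\<nu> = real_of_ereal m"
  have m_eq: "m = ereal \<nu>" using m_pos m_fin by (cases m) (auto simp: \<nu>_def)
  have \<nu>_pos: "0 < \<nu>" using m_pos m_eq by simp
  define L where "L n = real n powr (- a) * real (Max (w n ` {-2..int n}))" for n
  have L_ge: "real n powr (- a) * real (w n j) \<le> L n" if "-2 \<le> j" "j \<le> int n" for n j
    unfolding L_def using that by (intro mult_left_mono) (auto intro!: Max_ge)
  have L_attained: "\<exists>j\<in>{-2..int n}. L n = real n powr (- a) * real (w n j)" for n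
  proof -
    have "Max (w n ` {-2..int n}) \<in> w n ` {-2..int n}" by (intro Max_in) auto
    then obtain j where "j \<in> {-2..int n}" "Max (w n ` {-2..int n}) = w n j" by (rule imageE)
    then show ?thesis unfolding L_def by metis
  qed
  have "L \<longlonglongrightarrow> \<nu>"
  proof (rule order_tendstoI)
    fix y assume "y < \<nu>"
    then have "ereal y < m" using m_eq by simp
    then obtain j where j: "-2 \<le> j" "y < z j" unfolding m_def less_SUP_iff by auto
    have "\<forall>\<^sub>F n in sequentially. y < real n powr (- a) * real (w n j)"
      using order_tendstoD(1)[OF lim[OF j(1)] j(2)] .
    moreover have "\<forall>\<^sub>F n in sequentially. nat j \<le> n" by (rule eventually_ge_at_top)
    ultimately show "\<forall>\<^sub>F n in sequentially. y < L n"
    proof eventually_elim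
      case (elim n)
      then show ?case using L_ge[of j n] j by linarith
    qed
  next
    fix y assume y: "\<nu> < y"
    obtain J N where JN: "\<forall>j\<ge>J. \<forall>n\<ge>N. real (w n (int j)) \<le> \<nu> / 2 * real n powr a"
      using small[of "\<nu> / 2"] \<nu>_pos by auto
    have "\<forall>\<^sub>F n in sequentially. real n powr (- a) * real (w n j) < y" if "j \<in> {-2..int J}" for j
    proof (rule order_tendstoD(2)[OF lim])
      have "z j \<le> \<nu>" using z_le[of j] that m_eq by simp
      then show "z j < y" using y by simp
    qed (use that in simp)
    then have "\<forall>\<^sub>F n in sequentially. \<forall>j\<in>{-2..int J}. real n powr (- a) * real (w n j) < y"
      by (intro eventually_ball_finite) auto
    moreover have "\<forall>\<^sub>F n in sequentially. max 1 N \<le> n" by (rule eventually_ge_at_top)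
    ultimately show "\<forall>\<^sub>F n in sequentially. L n < y"
    proof eventually_elim
      case (elim n)
      obtain j where j: "j \<in> {-2..int n}" "L n = real n powr (- a) * real (w n j)"
        using L_attained by blast
      show ?case
      proof (cases "j \<le> int J")
        case True
        then show ?thesis using elim j by auto
      next
        case False
        then have "real (w n j) \<le> \<nu> / 2 * real n powr a"
          using JN[rule_format, of "nat j" n] elim by simp
        then have "L n \<le> real n powr (- a) * (\<nu> / 2 * real n powr a)"
          unfolding j(2) by (intro mult_left_mono) auto
        also have "\<dots> = \<nu> / 2" using elim by (simp add: powr_minus)
        finally show ?thesis using y \<nu>_pos by simp
      qed
    qed
  qed
  then have "(\<lambda>n. L n / \<nu>) \<longlonglongrightarrow> \<nu> / \<nu>" using \<nu>_pos by (intro tendsto_divide tendsto_const) auto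
  then show "(\<lambda>n. real (Max (w n ` {-2..int n})) / (real_of_ereal m * real n powr a)) \<longlonglongrightarrow> 1"
    using \<nu>_pos unfolding L_def by (simp add: powr_minus divide_simps mult.commute flip: \<nu>_def)
qed

theorem theorem5p1:
  fixes p q r :: real
    and M :: "'w measure"
    and X :: "nat \<Rightarrow> 'w \<Rightarrow> wgraph"
    and \<zeta> :: "int \<Rightarrow> 'w \<Rightarrow> real"
  assumes "0 < p" "p \<le> 1" "q \<in> {0..1}" "r \<in> {0..1}"
    and "graph_process p q r M X"
    and "\<And>j. j \<ge> -2 \<Longrightarrow> \<zeta> j \<in> borel_measurable M"
    and "\<And>j. j \<ge> -2 \<Longrightarrow> AE \<omega> in M. \<zeta> j \<omega> > 0"
    and "\<And>j. j \<ge> -2 \<Longrightarrow>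
           AE \<omega> in M. (\<lambda>n. real n powr (- \<alpha> p q r) * real (vertex_weight (X n \<omega>) j))
                        \<longlonglongrightarrow> \<zeta> j \<omega>"
    and "\<alpha> p q r > 0"
  shows "\<mu> \<zeta> \<in> borel_measurable M \<and>
         (AE \<omega> in M. 0 < \<mu> \<zeta> \<omega> \<and> \<mu> \<zeta> \<omega> < \<infinity>) \<and>
         (AE \<omega> in M. (\<lambda>n. real (max_weight n (X n \<omega>)) /
                            (real_of_ereal (\<mu> \<zeta> \<omega>) * real n powr \<alpha> p q r)) \<longlonglongrightarrow> 1)"
proof -
  note gp = assms(5)
  have p: "p \<in> {0..1}" using assms(1,2) by simp
  obtain c where c: "0 < c"
    and many: "AE \<omega> in M. \<forall>\<^sub>F n in sequentially. c * real n \<le> real (added (X n \<omega>))"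
    using AE_linearly_many_vertices[OF assms(1,2) gp] .
  \<comment> \<open>Thresholds \<open>1 / (i + 1)\<close> and starting times \<open>N + 1\<close> form a countable family, so the exceptional
    null sets can be combined.\<close>
  have small: "AE \<omega> in M. \<forall>i N. (\<forall>n\<ge>Suc N. c * real n \<le> real (added (X n \<omega>))) \<longrightarrow>
      (\<forall>\<^sub>F j in sequentially. \<forall>n\<ge>Suc N. real (vertex_weight (X n \<omega>) (int j))
         < inverse (real (Suc i)) * real n powr \<alpha> p q r)"
    unfolding AE_all_countable
    by (intro allI AE_young_vertices_small[OF p assms(3,4) gp assms(9) c]) auto
  have pos: "AE \<omega> in M. \<forall>j\<in>{-2..}. 0 < \<zeta> j \<omega>"
    using assms(7) by (intro AE_ball_countable[THEN iffD2] ballI) auto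
  have lim: "AE \<omega> in M. \<forall>j\<in>{-2..}.
      (\<lambda>n. real n powr (- \<alpha> p q r) * real (vertex_weight (X n \<omega>) j)) \<longlonglongrightarrow> \<zeta> j \<omega>"
    using assms(8) by (intro AE_ball_countable[THEN iffD2] ballI) auto
  have "AE \<omega> in M. (0 < \<mu> \<zeta> \<omega> \<and> \<mu> \<zeta> \<omega> < \<infinity>) \<and>
      (\<lambda>n. real (max_weight n (X n \<omega>)) /
         (real_of_ereal (\<mu> \<zeta> \<omega>) * real n powr \<alpha> p q r)) \<longlonglongrightarrow> 1"
    using many small pos lim
  proof eventually_elim
    case (elim \<omega>)
    let ?w = "\<lambda>n. vertex_weight (X n \<omega>)"
    have young: "\<exists>J N. \<forall>j\<ge>J. \<forall>n\<ge>N. real (?w n (int j)) \<le> e * real n powr \<alpha> p q r" if e: "0 < e" for e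
    proof -
      obtain N where "\<forall>n\<ge>N. c * real n \<le> real (added (X n \<omega>))"
        using elim(1) by (auto simp: eventually_sequentially)
      then have "\<forall>n\<ge>Suc N. c * real n \<le> real (added (X n \<omega>))" by simp
      moreover obtain i where i: "inverse (real (Suc i)) < e" using reals_Archimedean[OF e] ..
      ultimately obtain J where J: "\<forall>j\<ge>J. \<forall>n\<ge>Suc N.
          real (?w n (int j)) < inverse (real (Suc i)) * real n powr \<alpha> p q r"
        using elim(2) unfolding eventually_sequentially by meson
      have "real (?w n (int j)) \<le> e * real n powr \<alpha> p q r" if "J \<le> j" "Suc N \<le> n" for j n
      proof -
        have "real (?w n (int j)) \<le> inverse (real (Suc i)) * real n powr \<alpha> p q r"
          using J that by (intro less_imp_le) blast
        also have "\<dots> \<le> e * real n powr \<alpha> p q r" using i by (intro mult_right_mono) auto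
        finally show ?thesis .
      qed
      then show ?thesis by blast
    qed
    have "(\<lambda>n. real n powr (- \<alpha> p q r) * real (?w n j)) \<longlonglongrightarrow> \<zeta> j \<omega>" "0 < \<zeta> j \<omega>" if "-2 \<le> j" for j
      using elim(3,4) that by auto
    from max_asymptotics_of_columns[where w = ?w, OF this young]
    show ?case unfolding max_weight_def \<mu>_def by blast
  qed
  then have "AE \<omega> in M. 0 < \<mu> \<zeta> \<omega> \<and> \<mu> \<zeta> \<omega> < \<infinity>"
    "AE \<omega> in M. (\<lambda>n. real (max_weight n (X n \<omega>)) /
       (real_of_ereal (\<mu> \<zeta> \<omega>) * real n powr \<alpha> p q r)) \<longlonglongrightarrow> 1"
    by (auto elim: AE_mp)
  moreover have "\<mu> \<zeta> \<in> borel_measurable M"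
  proof -
    have "(\<lambda>\<omega>. SUP j\<in>{-2..}. ereal (\<zeta> j \<omega>)) \<in> borel_measurable M"
      using assms(6) by (intro borel_measurable_SUP borel_measurable_ereal) auto
    then show ?thesis unfolding \<mu>_def[abs_def] .
  qed
  ultimately show ?thesis by blast
qed

end
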